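(* Let the dimension be $d=1$. For any integer $k\ge 1$ and any real $\lambda>0$, \[ a_{k,\lambda} = 1 - \frac{\frac{\lambda^k}{k!}}{\sum_{l=0}^{k}\frac{\lambda^l}{l!}} = \frac{\sum_{m=0}^{k-1}\frac{\lambda^m}{m!}}{\sum_{l=0}^{k}\frac{\lambda^l}{l!}}. \]
   Context: For $V \subseteq \mathbb{R}$ and $r>0$, $G_r(V)$ is the graph with vertex set $V$ in which two distinct points $u,v\in V$ are adjacent if and only if $|u-v|\le r$. For $k \in \mathbb{N}=\{1,2,\dots\}$ and finite $V$, $N_{k,r}(V)$ is the maximum number of vertices of $G_r(V)$ that can be properly colored with $k$ colors, i.e., the largest cardinality of a subset $U\subseteq V$ such that the induced subgraph $G_r(U)$ is $k$-colorable. $\mathcal{X}_\lambda$ is a Poisson point process of (constant) intensity $\lambda$ in $\mathbb{R}$. Set $F_{k,\lambda}(t) = N_{k,1}([0,t] \cap \mathcal{X}_\lambda)$ and $\overline{F}_{k,\lambda}(t) = \mathbb{E}\{F_{k,\lambda}(t)\}/(\lambda t)$ for $t>0$. The constant is $a_{k,\lambda} = \inf_{t>0}\overline{F}_{k,\lambda}(t)$, which also equals $\lim_{t\to\infty}\overline{F}_{k,\lambda}(t)$ and the limit in probability of $F_{k,\lambda}(t)/(\lambda t)$ as $t\to\infty$. *)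

theory Defs
  imports "HOL-Probability.Probability"
begin

type_synonym 'v ugraph = "'v set \<times> 'v set set"

definition geometric_graph :: "real \<Rightarrow> real set \<Rightarrow> real ugraph" where
  "geometric_graph r V = (V, {{u, v} | u v. u \<in> V \<and> v \<in> V \<and> u \<noteq> v \<and> \<bar>u - v\<bar> \<le> r})"

definition k_colorable :: "nat \<Rightarrow> 'v ugraph \<Rightarrow> bool" where
  "k_colorable k G \<longleftrightarrow>
     (\<exists>c :: 'v \<Rightarrow> nat. c ` fst G \<subseteq> {..<k} \<and>
        (\<forall>u \<in> fst G. \<forall>v \<in> fst G. {u, v} \<in> snd G \<longrightarrow> c u \<noteq> c v))"

(* Meaningful for finite V only; the subgraph of geometric_graph r V induced by a
   subset U of V is geometric_graph r U. *)
definition max_colorable :: "nat \<Rightarrow> real \<Rightarrow> real set \<Rightarrow> nat" where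
  "max_colorable k r V = Max {card U | U. U \<subseteq> V \<and> k_colorable k (geometric_graph r U)}"

(* A Poisson point process has almost surely no multiple points, so it is modelled as a
   random locally finite set of reals; X \<omega> is the realization at outcome \<omega>.
   The library's poisson_pmf requires a positive rate, whereas a null set B gives rate 0
   (and then, with 0 ^ 0 = 1, the formula below is the point mass at 0). *)
locale poisson_point_process = prob_space M
  for M :: "'a measure" and X :: "'a \<Rightarrow> real set" and lam :: real +
  assumes locally_finite:
    "\<And>\<omega> B. \<omega> \<in> space M \<Longrightarrow> bounded B \<Longrightarrow> finite (X \<omega> \<inter> B)"
  and count_measurable:
    "\<And>B. B \<in> sets borel \<Longrightarrow> bounded B \<Longrightarrow>
       (\<lambda>\<omega>. card (X \<omega> \<inter> B)) \<in> measurable M (count_space UNIV)"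
  and count_poisson:
    "\<And>B n. B \<in> sets borel \<Longrightarrow> bounded B \<Longrightarrow>
       prob {\<omega> \<in> space M. card (X \<omega> \<inter> B) = n} =
         (lam * measure lborel B) ^ n / fact n * exp (- (lam * measure lborel B))"
  and count_indep:
    "\<And>(B :: nat \<Rightarrow> real set) n.
       (\<And>i. i < n \<Longrightarrow> B i \<in> sets borel \<and> bounded (B i)) \<Longrightarrow>
       disjoint_family_on B {..<n} \<Longrightarrow>
       indep_vars (\<lambda>_. count_space UNIV) (\<lambda>i \<omega>. card (X \<omega> \<inter> B i)) {..<n}"

definition F :: "nat \<Rightarrow> ('a \<Rightarrow> real set) \<Rightarrow> real \<Rightarrow> 'a \<Rightarrow> nat" where
  "F k X t \<omega> = max_colorable k 1 ({0..t} \<inter> X \<omega>)"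

definition F_bar :: "nat \<Rightarrow> real \<Rightarrow> 'a measure \<Rightarrow> ('a \<Rightarrow> real set) \<Rightarrow> real \<Rightarrow> real" where
  "F_bar k lam M X t = (\<integral>\<omega>. real (F k X t \<omega>) \<partial>M) / (lam * t)"

definition a_const :: "nat \<Rightarrow> real \<Rightarrow> 'a measure \<Rightarrow> ('a \<Rightarrow> real set) \<Rightarrow> real" where
  "a_const k lam M X = (INF t \<in> {0<..}. F_bar k lam M X t)"

end

(* Cut [0,t] into n slots of length t/n, and colour greedily from left to right, admitting an
   occupied slot if and only if fewer than k of the preceding v = ceil(n/t) slots were admitted.
   Greedy is optimal, and for fixed t and large n it selects exactly as many slots as there are
   points in a largest k-colourable set.  The slots are occupied independently with odds
   r = exp(lam t/n) - 1 to 1.  The window of the last v+1 admission bits is a Markov chain whose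
   stationary law is exactly that of independent bits conditioned on at most k ones (a
   discrete M/D/k/k loss system), so the mean number of admissions from a stationary start is known
   exactly; starting with no admitted slots changes it by at most k.  As n grows this
   gives c t <= E F(t) <= c t + k, where c/lam is one minus the Erlang loss probability. *)
theory Submission
  imports Defs "HOL-Real_Asymp.Real_Asymp"
begin

section \<open>Greedy selection of slots\<close>

text \<open>Slot version of "no clique of more than \<open>k\<close> points", which on the line is
  the only obstruction to \<open>k\<close>-colourability: the \<open>v + 1\<close> slots
  \<open>{a..a + v}\<close> play the role of a unit interval.\<close>

definition feasible :: "nat \<Rightarrow> nat \<Rightarrow> nat set \<Rightarrow> bool" where
  "feasible k v U \<longleftrightarrow> (\<forall>a. card (U \<inter> {a..a + v}) \<le> k)"

text \<open>\<open>T\<close> counts the slots already decided. Rejected slots leave no trace, as in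
  a loss system: an admission occupies one of \<open>k\<close> servers during the next
  \<open>v\<close> slots. Truncated subtraction cuts the look-back window off at slot 0.\<close>

primrec greedy :: "nat \<Rightarrow> nat \<Rightarrow> nat set \<Rightarrow> nat \<Rightarrow> nat set" where
  "greedy k v B 0 = {}"
| "greedy k v B (Suc T) =
     (if T \<in> B \<and> card (greedy k v B T \<inter> {T - v..<T}) < k
      then insert T (greedy k v B T) else greedy k v B T)"

lemma greedy_subset: "greedy k v B T \<subseteq> B \<inter> {..<T}"
  by (induction T) (auto simp: less_Suc_eq)

lemma finite_greedy [simp]: "finite (greedy k v B T)"
  using greedy_subset by (rule finite_subset) auto

lemma greedy_cong: "B \<inter> {..<T} = B' \<inter> {..<T} \<Longrightarrow> greedy k v B T = greedy k v B' T"
proof (induction T)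
  case (Suc T)
  have "B \<inter> {..<T} = B \<inter> {..<Suc T} \<inter> {..<T}" "B' \<inter> {..<T} = B' \<inter> {..<Suc T} \<inter> {..<T}"
    by auto
  with Suc.prems have "B \<inter> {..<T} = B' \<inter> {..<T}" by simp
  moreover have "T \<in> B \<longleftrightarrow> T \<in> B'"
    using arg_cong[OF Suc.prems, of "\<lambda>S. T \<in> S"] by simp
  ultimately show ?case using Suc.IH by simp
qed simp

lemma greedy_mono: "T \<le> T' \<Longrightarrow> greedy k v B T \<subseteq> greedy k v B T'"
  by (induction rule: dec_induct) auto

lemma feasible_subset: "feasible k v U \<Longrightarrow> U' \<subseteq> U \<Longrightarrow> feasible k v U'"
  unfolding feasible_def
proof (intro allI)
  fix a assume U: "\<forall>a. card (U \<inter> {a..a + v}) \<le> k" "U' \<subseteq> U"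
  then have "card (U' \<inter> {a..a + v}) \<le> card (U \<inter> {a..a + v})" by (intro card_mono) auto
  with U(1) show "card (U' \<inter> {a..a + v}) \<le> k" by (meson order_trans)
qed

text \<open>A new slot is the largest so far, so a window containing it meets the earlier admissions
  only among its \<open>v\<close> predecessors, where the admission test left room.\<close>

lemma feasible_greedy: "feasible k v (greedy k v B T)"
proof (induction T)
  case 0
  show ?case by (simp add: feasible_def)
next
  case (Suc T)
  let ?G = "greedy k v B T"
  show ?case
  proof (cases "T \<in> B \<and> card (?G \<inter> {T - v..<T}) < k")
    case True
    have "card (insert T ?G \<inter> {a..a + v}) \<le> k" for a
    proof (cases "T \<in> {a..a + v}")
      case T: True
      have "insert T ?G \<inter> {a..a + v} \<subseteq> insert T (?G \<inter> {T - v..<T})"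
        using T greedy_subset[of k v B T] by auto
      then have "card (insert T ?G \<inter> {a..a + v}) \<le> card (insert T (?G \<inter> {T - v..<T}))"
        by (intro card_mono) auto
      also have "\<dots> \<le> k"
        using True by (simp add: card_insert_if)
      finally show ?thesis .
    next
      case False
      then have "insert T ?G \<inter> {a..a + v} = ?G \<inter> {a..a + v}" by auto
      with Suc show ?thesis by (simp add: feasible_def)
    qed
    with True show ?thesis by (simp add: feasible_def)
  qed (use Suc in auto)
qed

text \<open>Strong induction on \<open>T\<close>. The critical case is a slot \<open>S\<close> of
  \<open>U\<close> with a full look-back window: greedy already has at least \<open>k\<close>
  admissions among the \<open>v\<close> preceding slots, while \<open>U\<close> has at most
  \<open>k\<close> in the window ending at \<open>S\<close>, so the comparison reduces to
  \<open>S - v\<close>.\<close>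

lemma greedy_optimal:
  assumes "feasible k v U" "U \<subseteq> B"
  shows "card (U \<inter> {..<T}) \<le> card (greedy k v B T)"
proof (induction T rule: less_induct)
  case (less T)
  show ?case
  proof (cases T)
    case (Suc S)
    let ?G = "greedy k v B S"
    show ?thesis
    proof (cases "S \<in> U")
      case False
      then have "U \<inter> {..<T} = U \<inter> {..<S}" using Suc by (auto simp: less_Suc_eq)
      moreover have "card (U \<inter> {..<S}) \<le> card ?G" using less Suc by simp
      moreover have "card ?G \<le> card (greedy k v B T)"
        using Suc by (intro card_mono greedy_mono) auto
      ultimately show ?thesis by simp
    next
      case True
      then have U: "U \<inter> {..<T} = insert S (U \<inter> {..<S})" using Suc by (auto simp: less_Suc_eq)
      show ?thesis
      proof (cases "card (?G \<inter> {S - v..<S}) < k")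
        case less': True
        have "S \<notin> ?G" using greedy_subset[of k v B S] by auto
        then have "card (greedy k v B T) = Suc (card ?G)"
          using less' True assms Suc by auto
        moreover have "card (U \<inter> {..<S}) \<le> card ?G" using less Suc by simp
        ultimately show ?thesis using U by simp
      next
        case ge: False
        \<comment> \<open>\<open>S - v + v\<close> is the larger of \<open>S\<close> and
          \<open>v\<close>; in this form the second piece is a window in the sense of
          \<open>feasible\<close> and still covers slot \<open>S\<close> when
          \<open>S < v\<close>.\<close>
        have "U \<inter> {..<T} \<subseteq> (U \<inter> {..<S - v}) \<union> (U \<inter> {S - v..S - v + v})"
          using Suc by auto
        then have "card (U \<inter> {..<T}) \<le> card ((U \<inter> {..<S - v}) \<union> (U \<inter> {S - v..S - v + v}))"
          by (intro card_mono) auto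
        also have "\<dots> \<le> card (U \<inter> {..<S - v}) + card (U \<inter> {S - v..S - v + v})"
          by (rule card_Un_le)
        also have "\<dots> \<le> card (greedy k v B (S - v)) + card (?G \<inter> {S - v..<S})"
          using ge assms(1) less[of "S - v"] Suc
          by (intro add_mono) (auto simp: feasible_def not_less intro: order_trans)
        also have "\<dots> = card (greedy k v B (S - v) \<union> (?G \<inter> {S - v..<S}))"
          using greedy_subset[of k v B "S - v"] by (intro card_Un_disjoint[symmetric]) auto
        also have "\<dots> \<le> card (greedy k v B T)"
          using greedy_mono[of "S - v" T k v B] greedy_mono[of S T k v B] Suc
          by (intro card_mono) auto
        finally show ?thesis .
      qed
    qed
  qed simp
qed

text \<open>Up to index \<open>v\<close> the look-back window is the whole past, and it misses the
  current slot, so it never reaches \<open>k\<close> at an occupied slot. Hence any set of at most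
  \<open>k\<close> slots can be planted in \<open>{0..v}\<close> as the initial window.\<close>

lemma greedy_eq_self:
  "T \<le> Suc v \<Longrightarrow> card (B \<inter> {..v}) \<le> k \<Longrightarrow> greedy k v B T = B \<inter> {..<T}"
proof (induction T)
  case (Suc T)
  then have IH: "greedy k v B T = B \<inter> {..<T}" by simp
  have "card (B \<inter> {..<T}) < k" if "T \<in> B"
  proof -
    have "B \<inter> {..<T} \<subset> B \<inter> {..v}" using that Suc.prems by auto
    then have "card (B \<inter> {..<T}) < card (B \<inter> {..v})" by (intro psubset_card_mono) auto
    with Suc show ?thesis by simp
  qed
  moreover have "B \<inter> {..<T} \<inter> {T - v..<T} = B \<inter> {..<T}" using Suc.prems by auto
  ultimately show ?case
    unfolding greedy.simps(2) IH lessThan_Suc by (cases "T \<in> B") simp_all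
qed simp

text \<open>Optimality of greedy, applied once to each input. The admissions beyond the initial
  window are feasible for \<open>A\<close> alone; conversely those from \<open>A\<close> are
  feasible for \<open>S \<union> A\<close>, whose greedy set has at most \<open>k\<close> elements
  in the initial window.\<close>

lemma greedy_initial_window:
  fixes S A :: "nat set"
  assumes "S \<subseteq> {..v}" "A \<subseteq> {Suc v..}"
  shows "card (greedy k v (S \<union> A) T \<inter> {Suc v..}) \<le> card (greedy k v A T)"
    and "card (greedy k v A T) \<le> k + card (greedy k v (S \<union> A) T \<inter> {Suc v..})"
proof -
  let ?G = "greedy k v (S \<union> A) T"
  have "feasible k v (?G \<inter> {Suc v..})"
    using feasible_greedy by (rule feasible_subset) auto
  moreover have "?G \<inter> {Suc v..} \<subseteq> A" using greedy_subset[of k v "S \<union> A" T] assms(1) by force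
  ultimately have "card (?G \<inter> {Suc v..} \<inter> {..<T}) \<le> card (greedy k v A T)"
    by (rule greedy_optimal)
  moreover have "?G \<inter> {Suc v..} \<inter> {..<T} = ?G \<inter> {Suc v..}"
    using greedy_subset[of k v "S \<union> A" T] by auto
  ultimately show "card (?G \<inter> {Suc v..}) \<le> card (greedy k v A T)" by simp
  have "greedy k v A T \<inter> {..<T} = greedy k v A T"
    using greedy_subset[of k v A T] by auto
  moreover have "card (greedy k v A T \<inter> {..<T}) \<le> card ?G"
    using greedy_subset[of k v A T] by (intro greedy_optimal feasible_greedy) auto
  ultimately have "card (greedy k v A T) \<le> card ?G" by simp
  moreover have "card ?G \<le> card (?G \<inter> {0..0 + v}) + card (?G \<inter> {Suc v..})"
    by (rule order_trans[OF card_mono card_Un_le]) (auto simp: not_less_eq_eq)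
  moreover have "card (?G \<inter> {0..0 + v}) \<le> k"
    using feasible_greedy[of k v "S \<union> A" T] unfolding feasible_def by blast
  ultimately show "card (greedy k v A T) \<le> k + card (?G \<inter> {Suc v..})" by linarith
qed

section \<open>The stationary loss system\<close>

lemma sum_Pow_insert:
  fixes f :: "'a set \<Rightarrow> 'b :: comm_monoid_add"
  assumes "finite I" "x \<notin> I"
  shows "(\<Sum>A\<in>Pow (insert x I). f A) = (\<Sum>A\<in>Pow I. f A + f (insert x A))"
proof -
  have "inj_on (insert x) (Pow I)" using assms(2) by (auto simp: inj_on_def insert_ident)
  then show ?thesis
    using assms unfolding Pow_insert
    by (subst sum.union_disjoint) (auto simp: sum.reindex sum.distrib)
qed

lemma sum_power_card_less:
  fixes r :: real
  assumes "finite I"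
  shows "(\<Sum>Q\<in>Pow I. if card Q < k then r ^ card Q else 0) = (\<Sum>j<k. real (card I choose j) * r ^ j)"
proof -
  have "(\<Sum>Q\<in>Pow I. if card Q < k then r ^ card Q else 0) = (\<Sum>Q\<in>{Q\<in>Pow I. card Q < k}. r ^ card Q)"
    using assms by (intro sum.inter_filter[symmetric]) auto
  also have "\<dots> = (\<Sum>j<k. \<Sum>Q\<in>{Q\<in>{Q\<in>Pow I. card Q < k}. card Q = j}. r ^ card Q)"
    using assms by (intro sum.group[symmetric]) auto
  also have "\<dots> = (\<Sum>j<k. real (card I choose j) * r ^ j)"
  proof (intro sum.cong refl)
    fix j assume "j \<in> {..<k}"
    then have "{Q\<in>{Q\<in>Pow I. card Q < k}. card Q = j} = {Q. Q \<subseteq> I \<and> card Q = j}" by auto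
    then show "(\<Sum>Q\<in>{Q\<in>{Q\<in>Pow I. card Q < k}. card Q = j}. r ^ card Q) = real (card I choose j) * r ^ j"
      using n_subsets[OF assms, of j] by simp
  qed
  finally show ?thesis .
qed

declare greedy.simps(2) [simp del]

text \<open>State space of the chain. Slots keep their absolute indices, so time moves the frame
  from \<open>{n..n + v}\<close> to \<open>{Suc n..Suc n + v}\<close> instead of shifting
  bits.\<close>

definition windows :: "nat \<Rightarrow> nat \<Rightarrow> nat \<Rightarrow> nat set set" where
  "windows k v n = {R \<in> Pow {n..n + v}. card R \<le> k}"

text \<open>Splits on the oldest index \<open>n\<close>, which is about to leave. The inner set
  \<open>Q\<close> lives on the \<open>v\<close> indices shared by the frames at \<open>n\<close>
  and \<open>Suc n\<close>, so that balance can be checked for each \<open>Q\<close>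
  separately.\<close>

lemma sum_windows_first:
  fixes f :: "nat set \<Rightarrow> real"
  shows "(\<Sum>R\<in>windows k v n. f R) =
    (\<Sum>Q\<in>Pow {Suc n..n + v}. (if card Q \<le> k then f Q else 0)
      + (if card Q < k then f (insert n Q) else 0))"
proof -
  have I: "{n..n + v} = insert n {Suc n..n + v}" by auto
  have "(\<Sum>R\<in>windows k v n. f R) = (\<Sum>R\<in>Pow {n..n + v}. if card R \<le> k then f R else 0)"
    unfolding windows_def by (intro sum.inter_filter) auto
  also have "\<dots> = (\<Sum>Q\<in>Pow {Suc n..n + v}. (if card Q \<le> k then f Q else 0)
      + (if card (insert n Q) \<le> k then f (insert n Q) else 0))"
    unfolding I by (intro sum_Pow_insert) auto
  also have "\<dots> = (\<Sum>Q\<in>Pow {Suc n..n + v}. (if card Q \<le> k then f Q else 0)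
      + (if card Q < k then f (insert n Q) else 0))"
  proof (intro sum.cong refl arg_cong2[of _ _ _ _ "(+)"] if_cong)
    fix Q assume "Q \<in> Pow {Suc n..n + v}"
    then have "finite Q" "n \<notin> Q" by (auto intro: finite_subset)
    then show "card (insert n Q) \<le> k \<longleftrightarrow> card Q < k" by auto
  qed
  finally show ?thesis .
qed

text \<open>Counterpart for the next frame, splitting on its newest index; the inner sets
  \<open>Q\<close> are the same as for the old frame.\<close>

lemma sum_windows_last:
  fixes f :: "nat set \<Rightarrow> real"
  shows "(\<Sum>R\<in>windows k v (Suc n). f R) =
    (\<Sum>Q\<in>Pow {Suc n..n + v}. (if card Q \<le> k then f Q else 0)
      + (if card Q < k then f (insert (Suc (n + v)) Q) else 0))"
proof -
  have I: "{Suc n..Suc n + v} = insert (Suc (n + v)) {Suc n..n + v}" by auto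
  have "(\<Sum>R\<in>windows k v (Suc n). f R) = (\<Sum>R\<in>Pow {Suc n..Suc n + v}. if card R \<le> k then f R else 0)"
    unfolding windows_def by (intro sum.inter_filter) auto
  also have "\<dots> = (\<Sum>Q\<in>Pow {Suc n..n + v}. (if card Q \<le> k then f Q else 0)
      + (if card (insert (Suc (n + v)) Q) \<le> k then f (insert (Suc (n + v)) Q) else 0))"
    unfolding I by (intro sum_Pow_insert) auto
  also have "\<dots> = (\<Sum>Q\<in>Pow {Suc n..n + v}. (if card Q \<le> k then f Q else 0)
      + (if card Q < k then f (insert (Suc (n + v)) Q) else 0))"
  proof (intro sum.cong refl arg_cong2[of _ _ _ _ "(+)"] if_cong)
    fix Q assume "Q \<in> Pow {Suc n..n + v}"
    then have "finite Q" "Suc (n + v) \<notin> Q" by (auto intro: finite_subset)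
    then show "card (insert (Suc (n + v)) Q) \<le> k \<longleftrightarrow> card Q < k" by auto
  qed
  finally show ?thesis .
qed

text \<open>Transition for an occupied incoming slot \<open>T\<close>, with \<open>R\<close> the
  window after its oldest index has been dropped; an empty slot leaves \<open>R\<close> as it
  is.\<close>

definition admit :: "nat \<Rightarrow> nat \<Rightarrow> nat set \<Rightarrow> nat set" where
  "admit k T R = (if card R < k then insert T R else R)"

text \<open>The weight \<open>r ^ card R\<close> on admissible windows is stationary; the factor \<open>1 + r\<close> is the total
  weight of the two possible states, empty and occupied, of the incoming slot.\<close>

lemma windows_stationary_step:
  fixes f :: "nat set \<Rightarrow> real" and r :: real
  shows "(\<Sum>R\<in>windows k v n. r ^ card R * (f (R - {n}) + r * f (admit k (Suc (n + v)) (R - {n}))))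
    = (1 + r) * (\<Sum>R\<in>windows k v (Suc n). r ^ card R * f R)"
  unfolding sum_windows_first[of _ k v n] sum_windows_last sum_distrib_left[where r = "1 + r"]
proof (intro sum.cong refl)
  fix Q assume "Q \<in> Pow {Suc n..n + v}"
  then have "finite Q" "n \<notin> Q" "Suc (n + v) \<notin> Q" by (auto intro: finite_subset)
  then show "(if card Q \<le> k then r ^ card Q * (f (Q - {n}) + r * f (admit k (Suc (n + v)) (Q - {n}))) else 0) +
     (if card Q < k then r ^ card (insert n Q) *
        (f (insert n Q - {n}) + r * f (admit k (Suc (n + v)) (insert n Q - {n}))) else 0) =
     (1 + r) * ((if card Q \<le> k then r ^ card Q * f Q else 0) +
        (if card Q < k then r ^ card (insert (Suc (n + v)) Q) * f (insert (Suc (n + v)) Q) else 0))"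
    \<comment> \<open>If \<open>card Q < k\<close>, the old windows \<open>Q\<close> and
      \<open>insert n Q\<close> have the same successors, and their weights add up to the factor
      \<open>1 + r\<close>. If \<open>card Q = k\<close>, only \<open>Q\<close> is an old window and
      the incoming slot is blocked, so its two states again give \<open>1 + r\<close>.\<close>
    by (cases "card Q < k") (simp_all add: admit_def algebra_simps)
qed

text \<open>Ties the greedy recursion to the chain: the look-back window of slot
  \<open>Suc (v + n)\<close> is the current frame without its oldest index \<open>n\<close>.\<close>

lemma greedy_step:
  fixes k :: nat
  assumes "S \<subseteq> {..v}" "A \<subseteq> {Suc v..v + n}"
  defines "G \<equiv> greedy k v (S \<union> A) (Suc (v + n))"
  shows "greedy k v (S \<union> A) (Suc (v + Suc n)) = G"
    and "greedy k v (S \<union> insert (Suc (v + n)) A) (Suc (v + Suc n)) =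
      (if card (G \<inter> {n..n + v} - {n}) < k then insert (Suc (v + n)) G else G)"
proof -
  let ?T = "Suc (v + n)"
  have T: "?T \<notin> S \<union> A" using assms by force
  then show "greedy k v (S \<union> A) (Suc (v + Suc n)) = G" by (simp add: G_def greedy.simps(2))
  have "greedy k v (S \<union> insert ?T A) ?T = G"
    unfolding G_def using T by (intro greedy_cong) auto
  moreover have "G \<inter> {n..n + v} - {n} = G \<inter> {?T - v..<?T}" by auto
  ultimately show "greedy k v (S \<union> insert ?T A) (Suc (v + Suc n)) =
      (if card (G \<inter> {n..n + v} - {n}) < k then insert ?T G else G)"
    by (simp add: greedy.simps(2))
qed

lemma windows_finite: "finite (windows k v n)"
  by (simp add: windows_def)

text \<open>Induction with \<open>f\<close> arbitrary: splitting off the newest slot turns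
  \<open>f\<close> into its image \<open>?f\<close> under the one-step transition operator, to which
  the induction hypothesis and then the balance identity apply.\<close>

lemma windows_stationary:
  fixes f :: "nat set \<Rightarrow> real" and r :: real
  shows "(\<Sum>S\<in>windows k v 0. \<Sum>A\<in>Pow {Suc v..v + n}. r ^ card S * r ^ card A *
      f (greedy k v (S \<union> A) (Suc (v + n)) \<inter> {n..n + v}))
    = (1 + r) ^ n * (\<Sum>R\<in>windows k v n. r ^ card R * f R)"
proof (induction n arbitrary: f)
  case 0
  have "greedy k v S (Suc v) \<inter> {..v} = S" if "S \<in> windows k v 0" for S
  proof -
    have S: "S \<subseteq> {..v}" "card S \<le> k" using that by (auto simp: windows_def)
    then have "S \<inter> {..v} = S" by auto
    then show ?thesis using greedy_eq_self[of "Suc v" v S k] S by (simp add: lessThan_Suc_atMost)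
  qed
  then show ?case by (simp add: atLeast0AtMost cong: sum.cong_simp)
next
  case (Suc n)
  let ?T = "Suc (v + n)"
  let ?f = "\<lambda>R. f (R - {n}) + r * f (admit k ?T (R - {n}))"
  have I: "{Suc v..v + Suc n} = insert ?T {Suc v..v + n}" by auto
  have "(\<Sum>A\<in>Pow {Suc v..v + Suc n}. r ^ card S * r ^ card A *
      f (greedy k v (S \<union> A) (Suc (v + Suc n)) \<inter> {Suc n..Suc n + v})) =
    (\<Sum>A\<in>Pow {Suc v..v + n}. r ^ card S * r ^ card A *
      ?f (greedy k v (S \<union> A) ?T \<inter> {n..n + v}))" if "S \<in> windows k v 0" for S
    unfolding I
  proof (subst sum_Pow_insert, goal_cases)
    case 3
    show ?case
    proof (intro sum.cong refl)
      fix A assume A: "A \<in> Pow {Suc v..v + n}"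
      let ?G = "greedy k v (S \<union> A) ?T"
      have S: "S \<subseteq> {..v}" using that by (auto simp: windows_def)
      have "finite A" "?T \<notin> A" using A by (auto intro: finite_subset)
      then have c: "card (insert ?T A) = Suc (card A)" by simp
      have "?G \<subseteq> {..<?T}" using greedy_subset[of k v "S \<union> A" ?T] by auto
      then have "?G \<inter> {Suc n..Suc n + v} = ?G \<inter> {n..n + v} - {n}"
        "insert ?T ?G \<inter> {Suc n..Suc n + v} = insert ?T (?G \<inter> {n..n + v} - {n})"
        by auto
      then show "r ^ card S * r ^ card A * f (greedy k v (S \<union> A) (Suc (v + Suc n)) \<inter> {Suc n..Suc n + v}) +
          r ^ card S * r ^ card (insert ?T A) *
            f (greedy k v (S \<union> insert ?T A) (Suc (v + Suc n)) \<inter> {Suc n..Suc n + v}) =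
          r ^ card S * r ^ card A * ?f (?G \<inter> {n..n + v})"
        using A S c greedy_step[of S v A n k]
        by (auto simp: admit_def algebra_simps)
    qed
  qed auto
  then have "(\<Sum>S\<in>windows k v 0. \<Sum>A\<in>Pow {Suc v..v + Suc n}. r ^ card S * r ^ card A *
      f (greedy k v (S \<union> A) (Suc (v + Suc n)) \<inter> {Suc n..Suc n + v})) =
    (\<Sum>S\<in>windows k v 0. \<Sum>A\<in>Pow {Suc v..v + n}. r ^ card S * r ^ card A *
      ?f (greedy k v (S \<union> A) ?T \<inter> {n..n + v}))"
    by (rule sum.cong[OF refl])
  also have "\<dots> = (1 + r) ^ n * (\<Sum>R\<in>windows k v n. r ^ card R * ?f R)"
    by (rule Suc.IH)
  also have "\<dots> = (1 + r) ^ Suc n * (\<Sum>R\<in>windows k v (Suc n). r ^ card R * f R)"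
    using windows_stationary_step[of r f n k v] by (simp add: add.commute)
  finally show ?case .
qed

lemma greedy_accepted_sum:
  fixes r :: real
  shows "(\<Sum>S\<in>windows k v 0. \<Sum>A\<in>Pow {Suc v..v + n}. r ^ card S * r ^ card A *
      real (card (greedy k v (S \<union> A) (Suc (v + n)) \<inter> {Suc v..})))
    = real n * r * (1 + r) ^ n * (\<Sum>j<k. real (v choose j) * r ^ j)"
proof (induction n)
  case 0
  have "greedy k v S (Suc v) \<inter> {Suc v..} = {}" for S
    using greedy_subset[of k v S "Suc v"] by auto
  then show ?case by (simp)
next
  case (Suc n)
  let ?T = "Suc (v + n)"
  let ?C = "\<Sum>j<k. real (v choose j) * r ^ j"
  \<comment> \<open>Indicator that the incoming slot would not be blocked.\<close>
  let ?f = "\<lambda>R. if card (R - {n}) < k then 1 else 0 :: real"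
  let ?G = "\<lambda>S A. greedy k v (S \<union> A) ?T"
  have I: "{Suc v..v + Suc n} = insert ?T {Suc v..v + n}" by auto
  have ring: "(1 + r) * (real n * r * (1 + r) ^ n * C) + r * ((1 + r) ^ n * ((1 + r) * C))
      = real (Suc n) * r * (1 + r) ^ Suc n * C" for C
    by (simp add: algebra_simps)
  have "(\<Sum>A\<in>Pow {Suc v..v + Suc n}. r ^ card S * r ^ card A *
      real (card (greedy k v (S \<union> A) (Suc (v + Suc n)) \<inter> {Suc v..}))) =
    (\<Sum>A\<in>Pow {Suc v..v + n}. (1 + r) * (r ^ card S * r ^ card A * real (card (?G S A \<inter> {Suc v..})))
      + r * (r ^ card S * r ^ card A * ?f (?G S A \<inter> {n..n + v})))" if "S \<in> windows k v 0" for S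
    unfolding I
  proof (subst sum_Pow_insert, goal_cases)
    case 3
    show ?case
    proof (intro sum.cong refl)
      fix A assume "A \<in> Pow {Suc v..v + n}"
      then have A: "A \<subseteq> {Suc v..v + n}" by simp
      have S: "S \<subseteq> {..v}" using that by (auto simp: windows_def)
      have "finite A" "?T \<notin> A" using A by (auto intro: finite_subset)
      then have c: "card (insert ?T A) = Suc (card A)" by simp
      have "?T \<notin> ?G S A" using greedy_subset[of k v "S \<union> A" ?T] by auto
      then have "card (insert ?T (?G S A) \<inter> {Suc v..}) = Suc (card (?G S A \<inter> {Suc v..}))"
        by (subst Int_insert_left_if1) auto
      then show "r ^ card S * r ^ card A * real (card (greedy k v (S \<union> A) (Suc (v + Suc n)) \<inter> {Suc v..})) +
          r ^ card S * r ^ card (insert ?T A) *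
            real (card (greedy k v (S \<union> insert ?T A) (Suc (v + Suc n)) \<inter> {Suc v..})) =
          (1 + r) * (r ^ card S * r ^ card A * real (card (?G S A \<inter> {Suc v..})))
            + r * (r ^ card S * r ^ card A * ?f (?G S A \<inter> {n..n + v}))"
        unfolding greedy_step[OF S A] c
        by (cases "card (?G S A \<inter> {n..n + v} - {n}) < k") (simp_all add: algebra_simps)
    qed
  qed auto
  then have "(\<Sum>S\<in>windows k v 0. \<Sum>A\<in>Pow {Suc v..v + Suc n}. r ^ card S * r ^ card A *
      real (card (greedy k v (S \<union> A) (Suc (v + Suc n)) \<inter> {Suc v..}))) =
    (1 + r) * (\<Sum>S\<in>windows k v 0. \<Sum>A\<in>Pow {Suc v..v + n}.
        r ^ card S * r ^ card A * real (card (?G S A \<inter> {Suc v..})))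
    + r * (\<Sum>S\<in>windows k v 0. \<Sum>A\<in>Pow {Suc v..v + n}.
        r ^ card S * r ^ card A * ?f (?G S A \<inter> {n..n + v}))"
    by (simp only: sum.distrib sum_distrib_left cong: sum.cong)
  also have "(\<Sum>S\<in>windows k v 0. \<Sum>A\<in>Pow {Suc v..v + n}.
        r ^ card S * r ^ card A * ?f (?G S A \<inter> {n..n + v})) =
      (1 + r) ^ n * (\<Sum>R\<in>windows k v n. r ^ card R * ?f R)"
    by (rule windows_stationary)
  \<comment> \<open>The oldest index has no influence on the admission test, so summing over its two
    states gives the factor \<open>1 + r\<close>.\<close>
  also have "(\<Sum>R\<in>windows k v n. r ^ card R * ?f R) =
      (\<Sum>Q\<in>Pow {Suc n..n + v}. (1 + r) * (if card Q < k then r ^ card Q else 0))"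
    unfolding sum_windows_first
  proof (intro sum.cong refl)
    fix Q assume "Q \<in> Pow {Suc n..n + v}"
    then have "finite Q" "n \<notin> Q" by (auto intro: finite_subset)
    then show "(if card Q \<le> k then r ^ card Q * ?f Q else 0) +
        (if card Q < k then r ^ card (insert n Q) * ?f (insert n Q) else 0) =
        (1 + r) * (if card Q < k then r ^ card Q else 0)"
      by (simp add: algebra_simps)
  qed
  also have "\<dots> = (1 + r) * ?C"
    by (simp add: sum_distrib_left[symmetric] sum_power_card_less)
  finally show ?case
    unfolding Suc.IH ring .
qed

section \<open>Normalising constants and the mean from an empty start\<close>

lemma sum_windows_weight:
  fixes r :: real
  shows "(\<Sum>S\<in>windows k v n. r ^ card S) = (\<Sum>j\<le>k. real (Suc v choose j) * r ^ j)"
proof -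
  have "(\<Sum>S\<in>windows k v n. r ^ card S) = (\<Sum>S\<in>Pow {n..n + v}. if card S < Suc k then r ^ card S else 0)"
    unfolding windows_def less_Suc_eq_le by (intro sum.inter_filter) auto
  also have "\<dots> = (\<Sum>j\<le>k. real (Suc v choose j) * r ^ j)"
    by (simp add: sum_power_card_less lessThan_Suc_atMost)
  finally show ?thesis .
qed

lemma sum_power_card_Pow:
  fixes r :: real
  assumes "finite I"
  shows "(\<Sum>A\<in>Pow I. r ^ card A) = (1 + r) ^ card I"
  using assms
proof (induction I)
  case (insert x I)
  have "(\<Sum>A\<in>Pow (insert x I). r ^ card A) = (\<Sum>A\<in>Pow I. (1 + r) * r ^ card A)"
    unfolding sum_Pow_insert[OF insert(1,2)]
  proof (intro sum.cong refl)
    fix A assume "A \<in> Pow I"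
    with insert(1,2) have "finite A" "x \<notin> A" by (auto intro: finite_subset)
    then show "r ^ card A + r ^ card (insert x A) = (1 + r) * r ^ card A"
      by (simp add: algebra_simps)
  qed
  with insert show ?case by (simp add: sum_distrib_left[symmetric])
qed simp

text \<open>\<open>E\<close> is the mean for an empty start and \<open>L\<close> the stationary
  mean. Multiplied by the total weight, both become double sums over initial windows and inputs, and
  the counts differ termwise by at most \<open>k\<close>.\<close>

lemma greedy_mean_bounds:
  fixes r :: real and k v n :: nat
  assumes "r > 0"
  defines "E \<equiv> (\<Sum>A\<in>Pow {Suc v..v + n}. r ^ card A * real (card (greedy k v A (Suc (v + n))))) / (1 + r) ^ n"
    and "L \<equiv> real n * r * (\<Sum>j<k. real (v choose j) * r ^ j) / (\<Sum>j\<le>k. real (Suc v choose j) * r ^ j)"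
  shows "L \<le> E" "E \<le> L + real k"
proof -
  let ?P = "Pow {Suc v..v + n}"
  let ?G = "\<lambda>S A. real (card (greedy k v (S \<union> A) (Suc (v + n)) \<inter> {Suc v..}))"
  let ?g = "\<lambda>A. real (card (greedy k v A (Suc (v + n))))"
  define Z where "Z = (\<Sum>S\<in>windows k v 0. r ^ card S)"
  have Zpos: "Z > 0"
  proof -
    have "(\<Sum>S\<in>{{} :: nat set}. r ^ card S) \<le> Z"
      unfolding Z_def using assms(1) by (intro sum_mono2) (auto simp: windows_finite, simp add: windows_def)
    then show ?thesis by simp
  qed
  have L: "L * Z * (1 + r) ^ n = (\<Sum>S\<in>windows k v 0. \<Sum>A\<in>?P. r ^ card S * r ^ card A * ?G S A)"
    using Zpos unfolding greedy_accepted_sum L_def Z_def sum_windows_weight by (simp add: field_simps)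
  have "E * (1 + r) ^ n = (\<Sum>A\<in>?P. r ^ card A * ?g A)"
    using assms(1) by (simp add: E_def)
  \<comment> \<open>The empty-start count does not involve \<open>S\<close>; the factor
    \<open>Z\<close> supplies the sum over initial windows.\<close>
  then have "E * Z * (1 + r) ^ n = Z * (\<Sum>A\<in>?P. r ^ card A * ?g A)" by simp
  also have "\<dots> = (\<Sum>S\<in>windows k v 0. \<Sum>A\<in>?P. r ^ card S * r ^ card A * ?g A)"
    unfolding Z_def sum_product by (simp only: mult.assoc)
  finally have E: "E * Z * (1 + r) ^ n = \<dots>" .
  have K: "real k * Z * (1 + r) ^ n = (\<Sum>S\<in>windows k v 0. \<Sum>A\<in>?P. r ^ card S * r ^ card A * real k)"
    using sum_power_card_Pow[of "{Suc v..v + n}" r] unfolding Z_def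
    by (simp add: sum_distrib_left[symmetric] sum_distrib_right[symmetric] mult_ac)
  have G: "?G S A \<le> ?g A" "?g A \<le> ?G S A + real k" if "S \<in> windows k v 0" "A \<in> ?P" for S A
  proof -
    have "S \<subseteq> {..v}" "A \<subseteq> {Suc v..}" using that by (auto simp: windows_def)
    from greedy_initial_window[OF this, of k "Suc (v + n)"]
    show "?G S A \<le> ?g A" "?g A \<le> ?G S A + real k" by simp_all
  qed
  have "L * Z * (1 + r) ^ n \<le> E * Z * (1 + r) ^ n"
    unfolding L E using assms(1) G by (intro sum_mono mult_left_mono) auto
  then show "L \<le> E" using Zpos assms(1) by simp
  have "E * Z * (1 + r) ^ n \<le> L * Z * (1 + r) ^ n + real k * Z * (1 + r) ^ n"
    unfolding L E K sum.distrib[symmetric] distrib_left[symmetric]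
    using assms(1) G by (intro sum_mono mult_left_mono) auto
  also have "\<dots> = (L + real k) * Z * (1 + r) ^ n" by (simp add: algebra_simps)
  finally show "E \<le> L + real k" using Zpos assms(1) by simp
qed

section \<open>Slots and colourable sets of points\<close>

text \<open>The indices \<open>0..v\<close> are left free for the initial window, so slots are numbered from \<open>v + 1\<close>;
  slot \<open>v + 1\<close> is closed on the left as well, so that it contains the point \<open>0\<close>.\<close>

definition slot :: "real \<Rightarrow> nat \<Rightarrow> real \<Rightarrow> nat" where
  "slot h v x = Suc v + nat (\<lceil>x / h\<rceil> - 1)"

lemma slot_upper:
  assumes "h > 0"
  shows "x \<le> (real (slot h v x) - real v) * h"
proof -
  have "x / h \<le> real (slot h v x) - real v"
    unfolding slot_def by linarith
  with assms show ?thesis by (simp add: field_simps)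
qed

text \<open>Every \<open>x <= h\<close> falls into slot \<open>Suc v\<close>, negative ones
  included, because \<open>nat\<close> truncates; hence the exclusion of the first slot.\<close>

lemma slot_lower:
  assumes "h > 0" "Suc v < slot h v x"
  shows "(real (slot h v x) - real v - 1) * h < x"
proof -
  have "real (slot h v x) - real v - 1 < x / h"
    using assms(2) unfolding slot_def by linarith
  with assms show ?thesis by (simp add: field_simps)
qed

text \<open>\<open>d + 1\<close> consecutive slots have total length \<open>(d + 1) * h\<close>.
  When \<open>x\<close> is in the first slot, the lower end 0 comes from the assumption
  \<open>0 <= x\<close>.\<close>

lemma slot_near:
  assumes "h > 0" "0 \<le> x" "slot h v y \<le> slot h v x + d"
  shows "y - x \<le> (real d + 1) * h"
proof (cases "Suc v < slot h v x")
  case True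
  have "y - x \<le> (real (slot h v y) - real v) * h - (real (slot h v x) - real v - 1) * h"
    using slot_upper[OF assms(1), of y v] slot_lower[OF assms(1) True] by simp
  also have "\<dots> = (real (slot h v y) - real (slot h v x) + 1) * h" by (simp add: algebra_simps)
  also have "\<dots> \<le> (real d + 1) * h"
    using assms by (intro mult_right_mono) auto
  finally show ?thesis .
next
  case False
  have "y - x \<le> (real (slot h v y) - real v) * h"
    using slot_upper[OF assms(1), of y v] assms(2) by simp
  also have "\<dots> \<le> (real d + 1) * h"
    using assms False by (intro mult_right_mono) auto
  finally show ?thesis .
qed

text \<open>At least \<open>d\<close> whole slots separate the two points. The slot of
  \<open>y\<close> is not the first one, hence open on the left, which makes the inequality
  strict.\<close>

lemma slot_far:
  assumes "h > 0" "slot h v x + Suc d \<le> slot h v y"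
  shows "real d * h < y - x"
proof -
  have "Suc v \<le> slot h v x" by (simp add: slot_def)
  then have y: "(real (slot h v y) - real v - 1) * h < y"
    using assms by (intro slot_lower) auto
  have "real d * h \<le> (real (slot h v y) - real (slot h v x) - 1) * h"
    using assms by (intro mult_right_mono) auto
  also have "\<dots> = (real (slot h v y) - real v - 1) * h - (real (slot h v x) - real v) * h"
    by (simp add: algebra_simps)
  also have "\<dots> < y - x" using y slot_upper[OF assms(1), of x v] by linarith
  finally show ?thesis .
qed

section \<open>Colourable point sets and feasible slot sets\<close>

lemma k_colorable_clique_le:
  assumes "k_colorable k (geometric_graph r U)" "C \<subseteq> U"
    and "\<And>x y. x \<in> C \<Longrightarrow> y \<in> C \<Longrightarrow> \<bar>x - y\<bar> \<le> r"
  shows "card C \<le> k"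
proof -
  obtain c :: "real \<Rightarrow> nat" where c: "c ` U \<subseteq> {..<k}"
    "\<And>u v. u \<in> U \<Longrightarrow> v \<in> U \<Longrightarrow> {u, v} \<in> snd (geometric_graph r U) \<Longrightarrow> c u \<noteq> c v"
    using assms(1) unfolding k_colorable_def geometric_graph_def by auto
  have "inj_on c C"
  proof (rule inj_onI, rule ccontr)
    fix x y assume xy: "x \<in> C" "y \<in> C" "c x = c y" "x \<noteq> y"
    then have "{x, y} \<in> snd (geometric_graph r U)"
      using assms(2,3) unfolding geometric_graph_def snd_conv by blast
    with c(2)[of x y] xy(1-3) assms(2) show False by (meson subsetD)
  qed
  moreover have "c ` C \<subseteq> {..<k}" using c(1) assms(2) by auto
  ultimately have "card C \<le> card {..<k}" by (intro card_inj_on_le) auto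
  then show ?thesis by simp
qed

text \<open>Points are coloured by the rank of their slot modulo \<open>k\<close>. Adjacent points
  lie within \<open>v\<close> slots of each other, so by feasibility their ranks differ by a number
  strictly between 0 and \<open>k\<close>.\<close>

lemma k_colorable_of_feasible_slots:
  assumes "k \<ge> 1" "h > 0" "real v * h \<ge> 1" "finite P"
    and inj: "inj_on (slot h v) P" and feas: "feasible k v (slot h v ` P)"
  shows "k_colorable k (geometric_graph 1 P)"
proof -
  let ?s = "slot h v"
  let ?rank = "\<lambda>x. card (?s ` P \<inter> {..<?s x})"
  have less: "?rank x mod k \<noteq> ?rank y mod k"
    if xy: "x \<in> P" "y \<in> P" "\<bar>x - y\<bar> \<le> 1" "?s x < ?s y" for x y
  proof -
    \<comment> \<open>A slot gap above \<open>v\<close> would put the points more than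
      \<open>v * h >= 1\<close> apart.\<close>
    have near: "?s y \<le> ?s x + v"
      using slot_far[OF assms(2), of v x v y] xy(3) assms(3) by (fastforce simp: not_le)
    have "?s ` P \<inter> {..<?s y} = (?s ` P \<inter> {..<?s x}) \<union> (?s ` P \<inter> {?s x..<?s y})"
      using xy(4) by auto
    then have rank: "?rank y = ?rank x + card (?s ` P \<inter> {?s x..<?s y})"
      by (simp only:) (subst card_Un_disjoint, use assms(4) in auto)
    have "?s x \<in> ?s ` P \<inter> {?s x..<?s y}" using xy by auto
    then have pos: "card (?s ` P \<inter> {?s x..<?s y}) > 0"
      using assms(4) by (auto simp: card_gt_0_iff)
    \<comment> \<open>The window starting at the slot of \<open>x\<close> also contains the slot of
      \<open>y\<close>, which the rank difference does not count; this makes the difference strictly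
      less than \<open>k\<close>.\<close>
    have "?s y \<in> ?s ` P \<inter> {?s x..?s x + v}" "?s y \<notin> ?s ` P \<inter> {?s x..<?s y}"
      using xy near by auto
    then have "?s ` P \<inter> {?s x..<?s y} \<subset> ?s ` P \<inter> {?s x..?s x + v}"
      using near by auto
    then have "card (?s ` P \<inter> {?s x..<?s y}) < card (?s ` P \<inter> {?s x..?s x + v})"
      by (intro psubset_card_mono) auto
    also have "\<dots> \<le> k" using feas by (simp add: feasible_def)
    finally have "\<not> k dvd card (?s ` P \<inter> {?s x..<?s y})" using pos by (simp add: nat_dvd_not_less)
    then show ?thesis
      using rank mod_eq_dvd_iff_nat[of "?rank x" "?rank y" k] by (metis diff_add_inverse le_add1)
  qed
  have "?rank x mod k \<noteq> ?rank y mod k" if "x \<in> P" "y \<in> P" "x \<noteq> y" "\<bar>x - y\<bar> \<le> 1" for x y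
  proof -
    have "?s x \<noteq> ?s y" using inj that by (auto dest: inj_onD)
    then consider "?s x < ?s y" | "?s y < ?s x" by linarith
    then show ?thesis
      using less[of x y] less[of y x] that by cases (auto simp: abs_minus_commute)
  qed
  then have "\<forall>x\<in>P. \<forall>y\<in>P. {x, y} \<in> snd (geometric_graph 1 P) \<longrightarrow> ?rank x mod k \<noteq> ?rank y mod k"
    by (auto simp: geometric_graph_def doubleton_eq_iff)
  then show ?thesis
    using assms(1) unfolding k_colorable_def
    by (intro exI[of _ "\<lambda>x. ?rank x mod k"]) (auto simp: geometric_graph_def)
qed

lemma k_colorable_empty: "k_colorable k (geometric_graph r {})"
  by (simp add: k_colorable_def geometric_graph_def)

lemma max_colorable_properties:
  assumes "finite V"
  shows max_colorable_ge: "U \<subseteq> V \<Longrightarrow> k_colorable k (geometric_graph r U) \<Longrightarrow> card U \<le> max_colorable k r V"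
    and max_colorable_attained:
      "\<exists>U\<subseteq>V. k_colorable k (geometric_graph r U) \<and> card U = max_colorable k r V"
proof -
  let ?S = "{card U | U. U \<subseteq> V \<and> k_colorable k (geometric_graph r U)}"
  have "?S \<subseteq> card ` Pow V" by auto
  then have fin: "finite ?S" using assms by (meson finite_Pow_iff finite_imageI finite_subset)
  then show "U \<subseteq> V \<Longrightarrow> k_colorable k (geometric_graph r U) \<Longrightarrow> card U \<le> max_colorable k r V"
    unfolding max_colorable_def by (intro Max_ge) auto
  \<comment> \<open>The empty set is colourable, so \<open>Max\<close> is taken over a nonempty
    set.\<close>
  have "?S \<noteq> {}" using k_colorable_empty by blast
  with fin have "max_colorable k r V \<in> ?S" unfolding max_colorable_def by (rule Max_in)
  then show "\<exists>U\<subseteq>V. k_colorable k (geometric_graph r U) \<and> card U = max_colorable k r V" by auto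
qed

lemma greedy_le_max_colorable:
  assumes "k \<ge> 1" "h > 0" "real v * h \<ge> 1" "finite V"
  shows "card (greedy k v (slot h v ` V) N) \<le> max_colorable k 1 V"
proof -
  let ?G = "greedy k v (slot h v ` V) N"
  have "\<forall>i\<in>?G. \<exists>x\<in>V. slot h v x = i" using greedy_subset[of k v "slot h v ` V" N] by auto
  then obtain f where f: "\<And>i. i \<in> ?G \<Longrightarrow> f i \<in> V" "\<And>i. i \<in> ?G \<Longrightarrow> slot h v (f i) = i"
    by metis
  have "slot h v ` (f ` ?G) = ?G" using f(2) by (auto simp: image_image)
  then have "k_colorable k (geometric_graph 1 (f ` ?G))"
    using assms f feasible_greedy[of k v "slot h v ` V" N]
    by (intro k_colorable_of_feasible_slots) (auto simp: inj_on_def)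
  then have "card (f ` ?G) \<le> max_colorable k 1 V"
    using assms(4) f by (intro max_colorable_ge) auto
  moreover have "card (f ` ?G) = card ?G"
    using f(2) by (intro card_image) (metis inj_onI)
  ultimately show ?thesis by simp
qed

text \<open>\<open>sep\<close> puts distinct points into distinct slots. By \<open>adj\<close>,
  points whose slots share a window form a clique, so a colourable set occupies feasible slots and
  optimality of greedy applies.\<close>

lemma max_colorable_le_greedy:
  assumes "h > 0" "finite V" "V \<subseteq> {0..}" "slot h v ` V \<subseteq> {..<N}"
    and sep: "\<And>x y. x \<in> V \<Longrightarrow> y \<in> V \<Longrightarrow> x \<noteq> y \<Longrightarrow> \<bar>x - y\<bar> > h"
    and adj: "\<And>x y. x \<in> V \<Longrightarrow> y \<in> V \<Longrightarrow> \<bar>x - y\<bar> \<le> (real v + 1) * h \<Longrightarrow> \<bar>x - y\<bar> \<le> 1"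
  shows "max_colorable k 1 V \<le> card (greedy k v (slot h v ` V) N)"
proof -
  let ?s = "slot h v"
  obtain U where U: "U \<subseteq> V" "k_colorable k (geometric_graph 1 U)" "card U = max_colorable k 1 V"
    using max_colorable_attained[OF assms(2)] by metis
  have near: "\<bar>x - y\<bar> \<le> (real d + 1) * h"
    if "x \<in> V" "y \<in> V" "?s x \<le> ?s y + d" "?s y \<le> ?s x + d" for x y d
    using slot_near[OF assms(1), of x v y d] slot_near[OF assms(1), of y v x d] that assms(3)
    by (fastforce simp: abs_le_iff)
  have "inj_on ?s V"
    using near[of _ _ 0] sep by (intro inj_onI) (force simp: not_less[symmetric])
  then have inj: "inj_on ?s U" using U(1) by (rule inj_on_subset)
  have "card (?s ` U \<inter> {a..a + v}) \<le> k" for a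
  proof -
    let ?C = "{x \<in> U. ?s x \<in> {a..a + v}}"
    have "finite U" using U(1) assms(2) by (rule finite_subset)
    have "?s ` U \<inter> {a..a + v} = ?s ` ?C" by auto
    then have "card (?s ` U \<inter> {a..a + v}) \<le> card ?C"
      using card_image_le[of ?C ?s] \<open>finite U\<close> by simp
    also have "\<dots> \<le> k"
      using U near[of _ _ v] by (intro k_colorable_clique_le[OF U(2)] adj near) auto
    finally show ?thesis .
  qed
  then have "card (?s ` U \<inter> {..<N}) \<le> card (greedy k v (?s ` V) N)"
    using U(1) by (intro greedy_optimal) (auto simp: feasible_def)
  moreover have "?s ` U \<inter> {..<N} = ?s ` U" using assms(4) U(1) by auto
  ultimately show ?thesis using inj U(3) by (simp add: card_image)
qed

text \<open>Each unit cell \<open>[j, j + 1)\<close> is a clique and contributes at most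
  \<open>k\<close> points. This is the constant bound for dominated convergence.\<close>

lemma max_colorable_bound:
  assumes "finite V" "V \<subseteq> {0..t}"
  shows "max_colorable k 1 V \<le> (nat \<lfloor>t\<rfloor> + 1) * k"
proof -
  obtain U where U: "U \<subseteq> V" "k_colorable k (geometric_graph 1 U)" "card U = max_colorable k 1 V"
    using max_colorable_attained[OF assms(1)] by metis
  let ?C = "\<lambda>j. {x \<in> U. nat \<lfloor>x\<rfloor> = j}"
  have "U \<subseteq> (\<Union>j\<in>{..nat \<lfloor>t\<rfloor>}. ?C j)"
    using U(1) assms(2) by (force intro: nat_mono floor_mono)
  moreover have "finite U" using U(1) assms(1) by (rule finite_subset)
  ultimately have "card U \<le> card (\<Union>j\<in>{..nat \<lfloor>t\<rfloor>}. ?C j)" by (intro card_mono) auto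
  also have "\<dots> \<le> (\<Sum>j\<le>nat \<lfloor>t\<rfloor>. card (?C j))" by (rule card_UN_le) auto
  also have "\<dots> \<le> (\<Sum>j\<le>nat \<lfloor>t\<rfloor>. k)"
  proof (intro sum_mono k_colorable_clique_le[OF U(2)])
    fix j x y assume "x \<in> ?C j" "y \<in> ?C j"
    moreover from this have "0 \<le> x" "0 \<le> y" using U(1) assms(2) by auto
    ultimately show "\<bar>x - y\<bar> \<le> 1" by simp linarith
  qed auto
  finally show ?thesis using U(3) by simp
qed

section \<open>The expected number of colourable Poisson points\<close>

lemma slot_le:
  assumes "n \<ge> 1" "t > 0" "x \<le> t"
  shows "slot (t / real n) v x \<le> v + n"
proof -
  have "x / (t / real n) \<le> real n" using assms by (simp add: field_simps)
  then have "\<lceil>x / (t / real n)\<rceil> \<le> int n" by (simp add: ceiling_le_iff)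
  then show ?thesis using assms(1) unfolding slot_def by linarith
qed

lemma slot_fibre:
  assumes "n \<ge> 1" "t > 0" "i < n"
  defines "h \<equiv> t / real n"
  shows "{x \<in> {0..t}. slot h v x = Suc v + i} = (if i = 0 then {0..h} else {real i * h<..(real i + 1) * h})"
proof -
  have h: "h > 0" "real n * h = t" using assms by (auto simp: h_def)
  have le: "(real i + 1) * h \<le> t"
    unfolding h(2)[symmetric] using assms(3) h(1) by (intro mult_right_mono) auto
  have "slot h v x = Suc v + i \<longleftrightarrow> (i = 0 \<or> real i < x / h) \<and> x / h \<le> real i + 1" for x
    unfolding slot_def by (cases "i = 0") (simp, linarith+)
  then have slot: "slot h v x = Suc v + i \<longleftrightarrow> (i = 0 \<or> real i * h < x) \<and> x \<le> (real i + 1) * h" for x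
    using h(1) by (simp add: field_simps)
  have "0 \<le> real i * h" using h(1) by simp
  then show ?thesis
    unfolding slot using le by (auto intro: order_trans less_imp_le)
qed

text \<open>Slots hold independent Poisson counts of mean \<open>lam * h\<close>, so each is empty
  with probability \<open>exp (- (lam * h))\<close>. With odds \<open>r = exp (lam * h) - 1\<close>
  the law is exactly the input weight \<open>r ^ card A / (1 + r) ^ n\<close> of the chain.\<close>

lemma (in poisson_point_process) prob_occupied_slots:
  assumes "n \<ge> 1" "t > 0" "A \<subseteq> {Suc v..v + n}"
  defines "h \<equiv> t / real n"
  defines "E \<equiv> {\<omega> \<in> space M. slot h v ` ({0..t} \<inter> X \<omega>) = A}"
  shows "E \<in> events" "prob E = (exp (lam * h) - 1) ^ card A / exp (lam * h) ^ n"
proof -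
  define B where "B i = {x \<in> {0..t}. slot h v x = Suc v + i}" for i
  \<comment> \<open>Admissible counts in slot \<open>i\<close>: nonzero if the slot must be
    occupied, zero otherwise.\<close>
  define S where "S i = (if Suc v + i \<in> A then - {0} else {0 :: nat})" for i
  have h: "h > 0" using assms by (simp add: h_def)
  have B: "B i = (if i = 0 then {0..h} else {real i * h<..(real i + 1) * h})" if "i < n" for i
    using slot_fibre[OF assms(1,2) that] by (simp add: B_def h_def)
  have B_borel: "B i \<in> sets borel \<and> bounded (B i)" if "i < n" for i
    using B[OF that] by auto
  have B_measure: "measure lborel (B i) = h" if "i < n" for i
    using B[OF that] h by (simp add: algebra_simps)
  have disj: "disjoint_family_on B {..<n}"
    by (auto simp: disjoint_family_on_def B_def)
  have count: "(\<lambda>\<omega>. card (X \<omega> \<inter> B i)) \<in> measurable M (count_space UNIV)" if "i < n" for i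
    using count_measurable B_borel[OF that] by blast
  define V where "V i = (\<lambda>\<omega>. card (X \<omega> \<inter> B i)) -` S i \<inter> space M" for i
  have V_events: "V i \<in> events" if "i < n" for i
    unfolding V_def using count[OF that] by (rule measurable_sets) simp
  have E_eq: "E = (\<Inter>i\<in>{..<n}. V i)"
  proof -
    have "slot h v ` ({0..t} \<inter> X \<omega>) = A \<longleftrightarrow> (\<forall>i<n. card (X \<omega> \<inter> B i) \<in> S i)" if "\<omega> \<in> space M" for \<omega>
    proof -
      let ?O = "slot h v ` ({0..t} \<inter> X \<omega>)"
      have "?O \<subseteq> {Suc v..v + n}"
        using slot_le[OF assms(1,2), of _ v] by (auto simp: h_def slot_def)
      then have "?O = A \<longleftrightarrow> (\<forall>j\<in>{Suc v..v + n}. j \<in> ?O \<longleftrightarrow> j \<in> A)" using assms(3) by blast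
      also have "{Suc v..v + n} = (\<lambda>i. Suc v + i) ` {..<n}"
        using image_add_atLeastLessThan[of "Suc v" 0 n]
        by (simp add: atLeast0LessThan atLeastLessThanSuc_atLeastAtMost add.commute)
      also have "(\<forall>j\<in>(\<lambda>i. Suc v + i) ` {..<n}. j \<in> ?O \<longleftrightarrow> j \<in> A)
          \<longleftrightarrow> (\<forall>i<n. Suc v + i \<in> ?O \<longleftrightarrow> Suc v + i \<in> A)" by auto
      also have "\<dots> \<longleftrightarrow> (\<forall>i<n. card (X \<omega> \<inter> B i) \<in> S i)"
      proof (intro all_cong)
        fix i assume "i < n"
        \<comment> \<open>Local finiteness excludes an infinite intersection, whose
          \<open>card\<close> would be 0 as well.\<close>
        then have "finite (X \<omega> \<inter> B i)" using locally_finite[OF that] B_borel by blast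
        then have "card (X \<omega> \<inter> B i) = 0 \<longleftrightarrow> X \<omega> \<inter> B i = {}" by simp
        also have "\<dots> \<longleftrightarrow> Suc v + i \<notin> ?O"
          unfolding B_def image_iff set_eq_iff Bex_def Int_iff mem_Collect_eq empty_iff
          by metis
        finally show "(Suc v + i \<in> ?O \<longleftrightarrow> Suc v + i \<in> A) \<longleftrightarrow> card (X \<omega> \<inter> B i) \<in> S i"
          by (auto simp: S_def)
      qed
      finally show ?thesis .
    qed
    then have "E = {\<omega> \<in> space M. \<forall>i<n. card (X \<omega> \<inter> B i) \<in> S i}"
      unfolding E_def by (intro Collect_cong conj_cong refl)
    moreover have "0 < n" using assms(1) by simp
    ultimately show ?thesis unfolding V_def by blast
  qed
  show "E \<in> events"
    unfolding E_eq using assms(1) V_events by (intro sets.finite_INT) (auto simp: lessThan_empty_iff)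
  have empty: "prob ((\<lambda>\<omega>. card (X \<omega> \<inter> B i)) -` {0} \<inter> space M) = exp (- (lam * h))" if "i < n" for i
  proof -
    have "(\<lambda>\<omega>. card (X \<omega> \<inter> B i)) -` {0} \<inter> space M = {\<omega> \<in> space M. card (X \<omega> \<inter> B i) = 0}" by auto
    then show ?thesis using count_poisson[of "B i" 0] B_borel[OF that] B_measure[OF that] by simp
  qed
  have V_prob: "prob (V i) = (if Suc v + i \<in> A then exp (lam * h) - 1 else 1) / exp (lam * h)"
    if "i < n" for i
  proof (cases "Suc v + i \<in> A")
    case True
    then have "V i = space M - (\<lambda>\<omega>. card (X \<omega> \<inter> B i)) -` {0} \<inter> space M"
      by (auto simp: V_def S_def)
    moreover have "(\<lambda>\<omega>. card (X \<omega> \<inter> B i)) -` {0} \<inter> space M \<in> events"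
      using count[OF that] by (rule measurable_sets) simp
    ultimately have "prob (V i) = 1 - exp (- (lam * h))"
      using empty[OF that] by (simp add: prob_compl)
    with True show ?thesis by (simp add: exp_minus field_simps)
  next
    case False
    then show ?thesis using empty[OF that] by (simp add: V_def S_def exp_minus field_simps)
  qed
  have "prob E = (\<Prod>i<n. prob (V i))"
    unfolding E_eq V_def
    using assms(1) count_indep[of n B, OF B_borel disj]
    by (intro indep_varsD[where M' = "\<lambda>_. count_space UNIV"]) (auto simp: lessThan_empty_iff)
  also have "\<dots> = (\<Prod>i<n. (if Suc v + i \<in> A then exp (lam * h) - 1 else 1) / exp (lam * h))"
    using V_prob by (intro prod.cong) auto
  also have "\<dots> = (\<Prod>i<n. if Suc v + i \<in> A then exp (lam * h) - 1 else 1) / exp (lam * h) ^ n"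
    by (simp add: prod_dividef)
  also have "(\<Prod>i<n. if Suc v + i \<in> A then exp (lam * h) - 1 else 1)
      = (\<Prod>j\<in>{Suc v..v + n}. if j \<in> A then exp (lam * h) - 1 else 1)"
    by (rule prod.reindex_bij_witness[of _ "\<lambda>j. j - Suc v" "\<lambda>i. Suc v + i"]) auto
  also have "\<dots> = (exp (lam * h) - 1) ^ card A"
    using assms(3) by (simp add: prod.If_cases Int_absorb1)
  finally show "prob E = (exp (lam * h) - 1) ^ card A / exp (lam * h) ^ n" .
qed

text \<open>The occupied set takes finitely many values, each on an event, so \<open>g\<close> of it
  is a finite combination of indicators. Measurability of \<open>F\<close> is later derived from
  this.\<close>

lemma (in poisson_point_process) occupied_slots_expectation:
  fixes g :: "nat set \<Rightarrow> real"
  assumes "n \<ge> 1" "t > 0"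
  defines "h \<equiv> t / real n"
  shows "(\<lambda>\<omega>. g (slot h v ` ({0..t} \<inter> X \<omega>))) \<in> borel_measurable M"
    and "expectation (\<lambda>\<omega>. g (slot h v ` ({0..t} \<inter> X \<omega>))) =
      (\<Sum>A\<in>Pow {Suc v..v + n}. (exp (lam * h) - 1) ^ card A * g A) / exp (lam * h) ^ n"
proof -
  let ?O = "\<lambda>\<omega>. slot h v ` ({0..t} \<inter> X \<omega>)"
  let ?P = "Pow {Suc v..v + n}"
  let ?E = "\<lambda>A. {\<omega> \<in> space M. ?O \<omega> = A}"
  have E: "?E A \<in> events" "prob (?E A) = (exp (lam * h) - 1) ^ card A / exp (lam * h) ^ n"
    if "A \<in> ?P" for A
    using prob_occupied_slots[OF assms(1,2), of A v] that by (simp_all add: h_def)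
  have eq: "g (?O \<omega>) = (\<Sum>A\<in>?P. indicator (?E A) \<omega> * g A)" if "\<omega> \<in> space M" for \<omega>
  proof -
    have "?O \<omega> \<in> ?P"
      using slot_le[OF assms(1,2), of _ v] by (auto simp: h_def slot_def)
    moreover have "(\<Sum>A\<in>?P. indicator (?E A) \<omega> * g A) = (\<Sum>A\<in>?P. if A = ?O \<omega> then g A else 0)"
      using that by (intro sum.cong) auto
    ultimately show ?thesis by simp
  qed
  have "(\<lambda>\<omega>. \<Sum>A\<in>?P. indicator (?E A) \<omega> * g A) \<in> borel_measurable M"
    using E(1) by (intro borel_measurable_sum borel_measurable_times borel_measurable_indicator) auto
  then show "(\<lambda>\<omega>. g (?O \<omega>)) \<in> borel_measurable M"
    using eq by (subst measurable_cong)
  have "expectation (\<lambda>\<omega>. g (?O \<omega>)) = expectation (\<lambda>\<omega>. \<Sum>A\<in>?P. indicator (?E A) \<omega> * g A)"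
    using eq by (intro Bochner_Integration.integral_cong) auto
  also have "\<dots> = (\<Sum>A\<in>?P. expectation (\<lambda>\<omega>. indicator (?E A) \<omega> * g A))"
    using E(1) by (intro Bochner_Integration.integral_sum integrable_mult_left
        integrable_real_indicator) (auto simp: emeasure_eq_measure)
  also have "\<dots> = (\<Sum>A\<in>?P. (exp (lam * h) - 1) ^ card A * g A / exp (lam * h) ^ n)"
  proof (intro sum.cong refl)
    fix A assume "A \<in> ?P"
    then show "expectation (\<lambda>\<omega>. indicator (?E A) \<omega> * g A) = (exp (lam * h) - 1) ^ card A * g A / exp (lam * h) ^ n"
      using E[of A] by simp
  qed
  finally show "expectation (\<lambda>\<omega>. g (?O \<omega>)) =
      (\<Sum>A\<in>?P. (exp (lam * h) - 1) ^ card A * g A) / exp (lam * h) ^ n"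
    by (simp add: sum_divide_distrib)
qed

section \<open>The limit of vanishing slot length\<close>

lemma ceiling_ratio_limit:
  fixes t :: real
  assumes "t > 0"
  shows "(\<lambda>n. real (nat \<lceil>real n / t\<rceil>) * (t / real n)) \<longlonglongrightarrow> 1"
proof (rule tendsto_sandwich)
  show "\<forall>\<^sub>F n in sequentially. 1 \<le> real (nat \<lceil>real n / t\<rceil>) * (t / real n)"
    using eventually_gt_at_top[of 0]
  proof eventually_elim
    case (elim n)
    have "real n / t \<le> real (nat \<lceil>real n / t\<rceil>)" by linarith
    then have "real n / t * (t / real n) \<le> real (nat \<lceil>real n / t\<rceil>) * (t / real n)"
      using assms by (intro mult_right_mono) auto
    with elim assms show ?case by simp
  qed
  show "\<forall>\<^sub>F n in sequentially. real (nat \<lceil>real n / t\<rceil>) * (t / real n) \<le> 1 + t / real n"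
    using eventually_gt_at_top[of 0]
  proof eventually_elim
    case (elim n)
    have "0 \<le> real n / t" using assms by simp
    then have "real (nat \<lceil>real n / t\<rceil>) \<le> real n / t + 1" by linarith
    then have "real (nat \<lceil>real n / t\<rceil>) * (t / real n) \<le> (real n / t + 1) * (t / real n)"
      using assms by (intro mult_right_mono) auto
    also have "(real n / t + 1) * (t / real n) = 1 + t / real n"
      using elim assms by (simp add: field_simps)
    finally show ?case .
  qed
  show "(\<lambda>n. 1 + t / real n) \<longlonglongrightarrow> 1" by real_asymp
qed simp

text \<open>The finite set \<open>V\<close> has finitely many distances. Eventually the mesh is
  below every positive one, and \<open>(v + 1) * h\<close>, which tends to 1, is below every one
  exceeding 1. Rounding up in \<open>v\<close> keeps \<open>v * h >= 1\<close> for the reverse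
  inequality.\<close>

lemma max_colorable_eventually_greedy:
  assumes "k \<ge> 1" "t > 0" "finite V" "V \<subseteq> {0..t}"
  shows "\<forall>\<^sub>F n in sequentially. max_colorable k 1 V =
    card (greedy k (nat \<lceil>real n / t\<rceil>) (slot (t / real n) (nat \<lceil>real n / t\<rceil>) ` V) (Suc (nat \<lceil>real n / t\<rceil> + n)))"
proof -
  let ?v = "\<lambda>n. nat \<lceil>real n / t\<rceil>"
  have h_lim: "(\<lambda>n. t / real n) \<longlonglongrightarrow> 0" by real_asymp
  have "\<forall>\<^sub>F n in sequentially. x \<noteq> y \<longrightarrow> \<bar>x - y\<bar> > t / real n" for x y
    using order_tendstoD(2)[OF h_lim, of "\<bar>x - y\<bar>"] by (cases "x = y") auto
  then have sep: "\<forall>\<^sub>F n in sequentially. \<forall>x\<in>V. \<forall>y\<in>V. x \<noteq> y \<longrightarrow> \<bar>x - y\<bar> > t / real n"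
    using assms(3) by (intro eventually_ball_finite ballI) auto
  have "(\<lambda>n. real (?v n) * (t / real n) + t / real n) \<longlonglongrightarrow> 1 + 0"
    using assms(2) by (intro tendsto_add ceiling_ratio_limit h_lim)
  then have lim: "(\<lambda>n. (real (?v n) + 1) * (t / real n)) \<longlonglongrightarrow> 1"
    by (simp only: distrib_right mult_1 add_0_right)
  have "\<forall>\<^sub>F n in sequentially. \<bar>x - y\<bar> \<le> (real (?v n) + 1) * (t / real n) \<longrightarrow> \<bar>x - y\<bar> \<le> 1" for x y
    using order_tendstoD(2)[OF lim, of "\<bar>x - y\<bar>"]
    by (cases "\<bar>x - y\<bar> \<le> 1") (auto elim: eventually_mono)
  then have adj: "\<forall>\<^sub>F n in sequentially. \<forall>x\<in>V. \<forall>y\<in>V.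
      \<bar>x - y\<bar> \<le> (real (?v n) + 1) * (t / real n) \<longrightarrow> \<bar>x - y\<bar> \<le> 1"
    using assms(3) by (intro eventually_ball_finite ballI) auto
  show ?thesis
    using sep adj eventually_gt_at_top[of 0]
  proof eventually_elim
    case (elim n)
    have "real n / t \<le> real (?v n)" by linarith
    then have "real n / t * (t / real n) \<le> real (?v n) * (t / real n)"
      using assms(2) by (intro mult_right_mono) auto
    then have v: "real (?v n) * (t / real n) \<ge> 1" using elim(3) assms(2) by simp
    show ?case
    proof (rule antisym)
      show "max_colorable k 1 V \<le> card (greedy k (?v n) (slot (t / real n) (?v n) ` V) (Suc (?v n + n)))"
      proof (rule max_colorable_le_greedy)
        show "slot (t / real n) (?v n) ` V \<subseteq> {..<Suc (?v n + n)}"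
          using slot_le[of n t _ "?v n"] elim(3) assms(2,4) by (auto simp: less_Suc_eq_le)
        show "V \<subseteq> {0..}" using assms(4) by auto
      qed (use elim assms in auto)
      show "card (greedy k (?v n) (slot (t / real n) (?v n) ` V) (Suc (?v n + n))) \<le> max_colorable k 1 V"
        using elim(3) assms v by (intro greedy_le_max_colorable) auto
    qed
  qed
qed

text \<open>At each outcome the greedy count eventually equals \<open>F\<close>, and it is bounded
  by a constant, so dominated convergence applies; the mean for each mesh is the explicit sum over
  inputs.\<close>

lemma (in poisson_point_process) expectation_F_limit:
  assumes "k \<ge> 1" "t > 0"
  defines "v \<equiv> \<lambda>n. nat \<lceil>real n / t\<rceil>"
  defines "r \<equiv> \<lambda>n. exp (lam * (t / real n)) - 1"
  shows "(\<lambda>n. (\<Sum>A\<in>Pow {Suc (v n)..v n + n}.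
      r n ^ card A * real (card (greedy k (v n) A (Suc (v n + n))))) / (1 + r n) ^ n)
    \<longlonglongrightarrow> expectation (\<lambda>\<omega>. real (F k X t \<omega>))"
proof -
  let ?V = "\<lambda>\<omega>. {0..t} \<inter> X \<omega>"
  let ?g = "\<lambda>n \<omega>. real (card (greedy k (v n) (slot (t / real n) (v n) ` ?V \<omega>) (Suc (v n + n))))"
  have fin: "finite (?V \<omega>)" if "\<omega> \<in> space M" for \<omega>
    using locally_finite[OF that, of "{0..t}"] by (simp add: Int_commute)
  have lim: "(\<lambda>n. ?g n \<omega>) \<longlonglongrightarrow> real (F k X t \<omega>)" if "\<omega> \<in> space M" for \<omega>
  proof (rule tendsto_eventually)
    show "\<forall>\<^sub>F n in sequentially. ?g n \<omega> = real (F k X t \<omega>)"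
      using max_colorable_eventually_greedy[OF assms(1,2) fin[OF that]]
      unfolding F_def v_def by (auto elim: eventually_mono)
  qed
  \<comment> \<open>The shift to \<open>Suc n\<close> avoids \<open>n = 0\<close>, where
    \<open>t / real n\<close> is 0 and there is no mesh.\<close>
  have meas: "?g (Suc n) \<in> borel_measurable M" for n
    using occupied_slots_expectation(1)[of "Suc n" t
        "\<lambda>A. real (card (greedy k (v (Suc n)) A (Suc (v (Suc n) + Suc n))))" "v (Suc n)"] assms(2)
    by simp
  have lim_Suc: "(\<lambda>n. ?g (Suc n) \<omega>) \<longlonglongrightarrow> real (F k X t \<omega>)" if "\<omega> \<in> space M" for \<omega>
    using lim[OF that] by (rule LIMSEQ_Suc)
  have bound: "norm (?g (Suc n) \<omega>) \<le> real ((nat \<lfloor>t\<rfloor> + 1) * k)" if "\<omega> \<in> space M" for n \<omega>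
  proof -
    have "real (Suc n) / t \<le> real (v (Suc n))" unfolding v_def by linarith
    then have "real (Suc n) / t * (t / real (Suc n)) \<le> real (v (Suc n)) * (t / real (Suc n))"
      using assms(2) by (intro mult_right_mono) auto
    then have "real (v (Suc n)) * (t / real (Suc n)) \<ge> 1" using assms(2) by simp
    then have "card (greedy k (v (Suc n)) (slot (t / real (Suc n)) (v (Suc n)) ` ?V \<omega>) (Suc (v (Suc n) + Suc n)))
        \<le> max_colorable k 1 (?V \<omega>)"
      using assms(1,2) fin[OF that] by (intro greedy_le_max_colorable) auto
    also have "\<dots> \<le> (nat \<lfloor>t\<rfloor> + 1) * k"
      using fin[OF that] by (intro max_colorable_bound) auto
    finally show ?thesis by (simp only: norm_of_nat of_nat_le_iff)
  qed
  have "(\<lambda>n. expectation (?g (Suc n))) \<longlonglongrightarrow> expectation (\<lambda>\<omega>. real (F k X t \<omega>))"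
  proof (rule integral_dominated_convergence)
    \<comment> \<open>\<open>F\<close> is measurable as a pointwise limit of functions of the
      occupied slots.\<close>
    show "(\<lambda>\<omega>. real (F k X t \<omega>)) \<in> borel_measurable M"
      using lim_Suc meas by (rule borel_measurable_LIMSEQ_real)
    show "integrable M (\<lambda>_. real ((nat \<lfloor>t\<rfloor> + 1) * k))" by simp
  qed (use meas lim_Suc bound in \<open>auto intro!: AE_I2\<close>)
  then have "(\<lambda>n. expectation (?g n)) \<longlonglongrightarrow> expectation (\<lambda>\<omega>. real (F k X t \<omega>))"
    by (rule LIMSEQ_imp_Suc)
  moreover have "\<forall>\<^sub>F n in sequentially. expectation (?g n) = (\<Sum>A\<in>Pow {Suc (v n)..v n + n}.
      r n ^ card A * real (card (greedy k (v n) A (Suc (v n + n))))) / (1 + r n) ^ n"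
    using eventually_gt_at_top[of 0]
  proof eventually_elim
    case (elim n)
    then show ?case
      using occupied_slots_expectation(2)[of n t
          "\<lambda>A. real (card (greedy k (v n) A (Suc (v n + n))))" "v n"] assms(2)
      by (simp add: r_def)
  qed
  ultimately show ?thesis by (rule Lim_transform_eventually)
qed

text \<open>Poisson limit of binomial weights: each of the \<open>j\<close> factors of the falling
  factorial absorbs one factor \<open>r n\<close> and then tends to \<open>c\<close>.\<close>

lemma binomial_power_limit:
  fixes r :: "nat \<Rightarrow> real" and w :: "nat \<Rightarrow> nat"
  assumes "(\<lambda>n. real (w n) * r n) \<longlonglongrightarrow> c" "r \<longlonglongrightarrow> 0"
  shows "(\<lambda>n. real (w n choose j) * r n ^ j) \<longlonglongrightarrow> c ^ j / fact j"
proof -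
  have "(\<lambda>n. (\<Prod>i<j. real (w n) * r n - real i * r n) / fact j) \<longlonglongrightarrow> (\<Prod>i<j. c - real i * 0) / fact j"
    using assms by (intro tendsto_intros) auto
  moreover have "real (w n choose j) * r n ^ j = (\<Prod>i<j. real (w n) * r n - real i * r n) / fact j" for n
    by (simp add: binomial_gbinomial gbinomial_prod_rev atLeast0LessThan
        left_diff_distrib[symmetric] prod.distrib)
  ultimately show ?thesis by simp
qed

lemma (in poisson_point_process) expectation_F_bounds:
  assumes "k \<ge> 1" "t > 0" "lam > 0"
  defines "c \<equiv> lam * (\<Sum>j<k. lam ^ j / fact j) / (\<Sum>j\<le>k. lam ^ j / fact j)"
  shows "c * t \<le> expectation (\<lambda>\<omega>. real (F k X t \<omega>))"
    and "expectation (\<lambda>\<omega>. real (F k X t \<omega>)) \<le> c * t + real k"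
proof -
  define v where "v n = nat \<lceil>real n / t\<rceil>" for n
  define r where "r n = exp (lam * (t / real n)) - 1" for n
  define L where "L n = real n * r n * (\<Sum>j<k. real (v n choose j) * r n ^ j)
      / (\<Sum>j\<le>k. real (Suc (v n) choose j) * r n ^ j)" for n
  define e where "e n = (\<Sum>A\<in>Pow {Suc (v n)..v n + n}.
      r n ^ card A * real (card (greedy k (v n) A (Suc (v n + n))))) / (1 + r n) ^ n" for n
  have e: "e \<longlonglongrightarrow> expectation (\<lambda>\<omega>. real (F k X t \<omega>))"
    using expectation_F_limit[OF assms(1,2)] unfolding e_def v_def r_def by simp
  have r0: "r \<longlonglongrightarrow> 0" unfolding r_def by real_asymp
  have nr: "(\<lambda>n. real n * r n) \<longlonglongrightarrow> lam * t"
    unfolding r_def using assms by real_asymp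
  \<comment> \<open>\<open>v n * r n\<close> is split into the window length
    \<open>v n * (t / n)\<close>, tending to 1, and \<open>n * r n / t\<close>, tending to
    \<open>lam\<close>.\<close>
  have "(\<lambda>n. real (v n) * (t / real n) * (real n * r n) / t) \<longlonglongrightarrow> 1 * (lam * t) / t"
    unfolding v_def using assms(2)
    by (intro tendsto_divide tendsto_mult[OF ceiling_ratio_limit nr] tendsto_const) auto
  moreover have "real (v n) * (t / real n) * (real n * r n) / t = real (v n) * r n" for n
    using assms(2) by (cases "n = 0") (auto simp: v_def)
  ultimately have vr: "(\<lambda>n. real (v n) * r n) \<longlonglongrightarrow> lam" using assms(2) by simp
  then have "(\<lambda>n. real (v n) * r n + r n) \<longlonglongrightarrow> lam + 0" using r0 by (rule tendsto_add)
  then have Svr: "(\<lambda>n. real (Suc (v n)) * r n) \<longlonglongrightarrow> lam" by (simp add: algebra_simps)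
  have Z: "(\<Sum>j\<le>k. lam ^ j / fact j) > 0"
    using assms(3) by (intro sum_pos) auto
  \<comment> \<open>Both binomial sums become truncated exponential series in \<open>lam\<close>;
    passing from \<open>v\<close> to \<open>v + 1\<close> slots makes no difference in the
    limit.\<close>
  have L: "L \<longlonglongrightarrow> c * t"
  proof -
    have "L \<longlonglongrightarrow> lam * t * (\<Sum>j<k. lam ^ j / fact j) / (\<Sum>j\<le>k. lam ^ j / fact j)"
      unfolding L_def using Z by (intro tendsto_divide tendsto_mult tendsto_sum nr
          binomial_power_limit vr Svr r0) auto
    then show ?thesis by (simp add: c_def mult_ac)
  qed
  have bounds: "L n \<le> e n" "e n \<le> L n + real k" if "n > 0" for n
  proof -
    have "r n > 0" using that assms by (simp add: r_def)
    from greedy_mean_bounds[OF this] show "L n \<le> e n" "e n \<le> L n + real k"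
      unfolding L_def e_def by blast+
  qed
  show "c * t \<le> expectation (\<lambda>\<omega>. real (F k X t \<omega>))"
    using bounds(1) by (intro tendsto_le[OF _ e L] eventually_mono[OF eventually_gt_at_top[of 0]]) auto
  have "(\<lambda>n. L n + real k) \<longlonglongrightarrow> c * t + real k" using L by (intro tendsto_intros)
  then show "expectation (\<lambda>\<omega>. real (F k X t \<omega>)) \<le> c * t + real k"
    using bounds(2) by (intro tendsto_le[OF _ _ e] eventually_mono[OF eventually_gt_at_top[of 0]]) auto
qed

text \<open>Dividing the bounds on the mean of \<open>F\<close> by \<open>lam * t\<close> puts
  \<open>F_bar\<close> between the Erlang value and that value plus \<open>k / (lam * t)\<close>, so
  the infimum over \<open>t\<close> is the Erlang value.\<close>

theorem mainTheorem4:
  fixes k :: nat and lam :: real and M :: "'a measure" and X :: "'a \<Rightarrow> real set"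
  assumes "k \<ge> 1" and "lam > 0" and "poisson_point_process M X lam"
  shows "a_const k lam M X = 1 - (lam ^ k / fact k) / (\<Sum>l = 0..k. lam ^ l / fact l)
    \<and> 1 - (lam ^ k / fact k) / (\<Sum>l = 0..k. lam ^ l / fact l)
        = (\<Sum>m = 0..k - 1. lam ^ m / fact m) / (\<Sum>l = 0..k. lam ^ l / fact l)"
proof -
  interpret poisson_point_process M X lam by fact
  let ?Z = "\<Sum>l\<le>k. lam ^ l / fact l"
  let ?a = "(\<Sum>m<k. lam ^ m / fact m) / ?Z"
  have Z: "?Z > 0" using assms(2) by (intro sum_pos) auto
  have "{0..k - 1} = {..<k}" "{0..k} = {..k}" using assms(1) by auto
  then have sums: "(\<Sum>m = 0..k - 1. lam ^ m / fact m) = (\<Sum>m<k. lam ^ m / fact m)"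
    "(\<Sum>l = 0..k. lam ^ l / fact l) = ?Z" by simp_all
  have "?Z = (\<Sum>m<k. lam ^ m / fact m) + lam ^ k / fact k"
    by (simp flip: lessThan_Suc_atMost)
  moreover have "1 - (lam ^ k / fact k) / ?Z = (?Z - lam ^ k / fact k) / ?Z"
    using Z by (simp add: diff_divide_distrib)
  ultimately have erlang: "1 - (lam ^ k / fact k) / ?Z = ?a" by simp
  have lower: "?a \<le> F_bar k lam M X t" if "t > 0" for t
    using expectation_F_bounds(1)[OF assms(1) that assms(2)] that assms(2) Z
    by (simp add: F_bar_def field_simps)
  have upper: "F_bar k lam M X t \<le> ?a + real k / (lam * t)" if "t > 0" for t
  proof -
    have "F_bar k lam M X t \<le> (lam * (\<Sum>m<k. lam ^ m / fact m) / ?Z * t + real k) / (lam * t)"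
      unfolding F_bar_def using expectation_F_bounds(2)[OF assms(1) that assms(2)] that assms(2)
      by (intro divide_right_mono) auto
    also have "\<dots> = ?a + real k / (lam * t)"
      using that assms(2) by (simp add: add_divide_distrib)
    finally show ?thesis .
  qed
  have "a_const k lam M X = ?a"
  proof (rule antisym)
    show "?a \<le> a_const k lam M X"
      unfolding a_const_def using lower by (intro cINF_greatest) auto
    show "a_const k lam M X \<le> ?a"
    proof (rule field_le_epsilon)
      fix e :: real assume e: "e > 0"
      \<comment> \<open>Chosen so that the error term \<open>k / (lam * t)\<close> equals
        \<open>e\<close>; positive because \<open>k >= 1\<close>.\<close>
      define t where "t = real k / (lam * e)"
      have t: "t > 0" using assms e by (simp add: t_def)
      have "a_const k lam M X \<le> F_bar k lam M X t"
        \<comment> \<open>The lower bound also shows that the real infimum is taken over a set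
          bounded below.\<close>
        unfolding a_const_def using lower t by (intro cINF_lower bdd_belowI2[of _ ?a]) auto
      also have "\<dots> \<le> ?a + real k / (lam * t)" by (rule upper[OF t])
      also have "real k / (lam * t) = e" using assms e by (simp add: t_def)
      finally show "a_const k lam M X \<le> ?a + e" .
    qed
  qed
  then show ?thesis unfolding sums erlang by simp
qed

end
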